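(* For positive reputation system settings, any two of the three postulates Generality (G), Transitivity (T) and Weak Monotonicity (M) can be satisfied simultaneously. That is: (i) there is a social reputation rule satisfying G and T; (ii) there is a social reputation rule satisfying G and M; (iii) there is a social reputation rule (defined on some nonempty class of settings) satisfying T and M.
   Context: A positive reputation system setting is a finite directed graph $G=(V,E)$ without self-loops, where $V$ is the set of agents and $E\subseteq V^2$ is the set of positive feedbacks ($(u,v)\in E$ means that $u$ gives positive feedback on $v$). For $v\in V$ let $R(v)=\{u\in V:(u,v)\in E\}$. A social ranking of $G$ is a function $S(G):V\to\{1,\dots,|V|\}$ (not necessarily injective). Write $v_i\ge v_j$ if $S(G)(v_i)\le S(G)(v_j)$ (so a smaller number means ranked higher), and $v_i>v_j$ if $v_i\ge v_j$ but not $v_j\ge v_i$. As usual $v\le w$ means $w\ge v$, and $v<w$ means $w>v$. A social reputation rule $S$ assigns to each positive reputation system setting $G$ in some nonempty class of settings (its domain) a social ranking $S(G)$ of the nodes of $G$. Given $G$ and $S(G)$, $R(v_i)$ is more important than $R(v_j)$ if there is an injective map $f:R(v_j)\to R(v_i)$ such that $v\le f(v)$ for every $v\in R(v_j)$, and either $f$ is not onto or there is at least one $v\in R(v_j)$ with $v<f(v)$. Postulates for a rule $S$: - Generality (G): $S$ is defined on every positive reputation system setting. - Transitivity (T): for every $G=(V,E)$ in the domain of $S$, with respect to $S(G)$: for all $v_i,v_j\in V$, if $R(v_i)$ is more important than $R(v_j)$ then $v_i>v_j$. - Weak Monotonicity (M): for every $G=(V,E)$ in the domain of $S$, with respect to $S(G)$: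 for all $v_i,v_j\in V$, if $R(v_i)$ is not more important than $R(v_j)$ but $v_i>v_j$, then there exist $v_1\in R(v_i)$ and $v_2\in R(v_j)$ such that $v_1>v_2$. *)

theory Defs
  imports "HOL-Library.FuncSet" "Graph_Theory.Pair_Digraph"
begin

text \<open>
  A positive reputation system setting is a finite loop-free directed graph, i.e. a \<open>G\<close> with
  \<^term>\<open>pair_digraph G\<close>: agents are \<^term>\<open>pverts G\<close>, positive feedbacks are \<^term>\<open>parcs G\<close>.
\<close>

definition raters :: "'a pair_pre_digraph \<Rightarrow> 'a \<Rightarrow> 'a set" where
  "raters G v = {u \<in> pverts G. (u, v) \<in> parcs G}"

text \<open>
  Rankings are extensional functions, so that they carry no information outside the vertex set.
  They need not be injective; a smaller number means ranked higher.
\<close>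

definition social_rankings :: "'a pair_pre_digraph \<Rightarrow> ('a \<Rightarrow> nat) set" where
  "social_rankings G = pverts G \<rightarrow>\<^sub>E {1..card (pverts G)}"

definition ranked_ge :: "('a \<Rightarrow> nat) \<Rightarrow> 'a \<Rightarrow> 'a \<Rightarrow> bool" where
  "ranked_ge r v w \<longleftrightarrow> r v \<le> r w"

definition ranked_gt :: "('a \<Rightarrow> nat) \<Rightarrow> 'a \<Rightarrow> 'a \<Rightarrow> bool" where
  "ranked_gt r v w \<longleftrightarrow> ranked_ge r v w \<and> \<not> ranked_ge r w v"

definition more_important :: "('a \<Rightarrow> nat) \<Rightarrow> 'a set \<Rightarrow> 'a set \<Rightarrow> bool" where
  "more_important r A B \<longleftrightarrow>
     (\<exists>f. f \<in> B \<rightarrow> A \<and> inj_on f B \<and> (\<forall>v\<in>B. ranked_ge r (f v) v) \<and>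
          (f ` B \<noteq> A \<or> (\<exists>v\<in>B. ranked_gt r (f v) v)))"

text \<open>A rule is a partial map on graphs; its domain is a nonempty class of settings.\<close>

type_synonym 'a ranking_rule = "'a pair_pre_digraph \<Rightarrow> ('a \<Rightarrow> nat) option"

definition social_reputation_rule :: "'a ranking_rule \<Rightarrow> bool" where
  "social_reputation_rule S \<longleftrightarrow>
     dom S \<noteq> {} \<and>
     (\<forall>G r. S G = Some r \<longrightarrow> pair_digraph G \<and> r \<in> social_rankings G)"

definition generality :: "'a ranking_rule \<Rightarrow> bool" where
  "generality S \<longleftrightarrow> (\<forall>G. pair_digraph G \<longrightarrow> G \<in> dom S)"

definition transitivity :: "'a ranking_rule \<Rightarrow> bool" where
  "transitivity S \<longleftrightarrow>
     (\<forall>G r. S G = Some r \<longrightarrow>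
        (\<forall>vi\<in>pverts G. \<forall>vj\<in>pverts G.
           more_important r (raters G vi) (raters G vj) \<longrightarrow> ranked_gt r vi vj))"

definition weak_monotonicity :: "'a ranking_rule \<Rightarrow> bool" where
  "weak_monotonicity S \<longleftrightarrow>
     (\<forall>G r. S G = Some r \<longrightarrow>
        (\<forall>vi\<in>pverts G. \<forall>vj\<in>pverts G.
           \<not> more_important r (raters G vi) (raters G vj) \<and> ranked_gt r vi vj \<longrightarrow>
             (\<exists>v1\<in>raters G vi. \<exists>v2\<in>raters G vj. ranked_gt r v1 v2)))"

end

theory Submission
  imports Defs Complex_Main
begin

text \<open>
  For Generality with Transitivity, rank agents by Katz centrality: with \<open>n\<close> agents and damping
  \<open>\<alpha> = 1 / (n + 1)\<close>, the number of walks of length \<open>k\<close> ending in \<open>v\<close> is at most \<open>n^k\<close>, so the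
  \<open>\<alpha>\<close>-weighted walk count \<open>x\<close> converges and satisfies \<open>x v = 1 + \<alpha> * (\<Sum>u \<in> R v. x u)\<close>. All
  values are positive, so a more important set of raters has a strictly larger sum.
  The constant ranking is weakly monotone, and on arcless graphs it is vacuously transitive as well.
\<close>

primrec walks_to :: "'a pair_pre_digraph \<Rightarrow> nat \<Rightarrow> 'a \<Rightarrow> real" where
  "walks_to G 0 v = 1"
| "walks_to G (Suc k) v = (\<Sum>u\<in>raters G v. walks_to G k u)"

text \<open>The \<open>+ 1\<close> makes the ratio n / (n + 1) strictly less than 1 and avoids
  division by zero on the empty graph.\<close>

definition damping :: "'a pair_pre_digraph \<Rightarrow> real" where
  "damping G = 1 / (real (card (pverts G)) + 1)"

definition katz :: "'a pair_pre_digraph \<Rightarrow> 'a \<Rightarrow> real" where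
  "katz G v = (\<Sum>k. walks_to G k v * damping G ^ k)"

lemma raters_subset: "raters G v \<subseteq> pverts G"
  by (auto simp: raters_def)

lemma damping_pos: "damping G > 0"
  by (simp add: damping_def add_nonneg_pos)

lemma walks_to_nonneg: "walks_to G k v \<ge> 0"
  by (induction k arbitrary: v) (auto intro: sum_nonneg)

lemma walks_to_le:
  assumes "finite (pverts G)"
  shows "walks_to G k v \<le> real (card (pverts G)) ^ k"
proof (induction k arbitrary: v)
  case (Suc k)
  have "walks_to G (Suc k) v \<le> (\<Sum>u\<in>raters G v. real (card (pverts G)) ^ k)"
    unfolding walks_to.simps by (intro sum_mono Suc.IH)
  also have "\<dots> = real (card (raters G v)) * real (card (pverts G)) ^ k"
    by simp
  also have "\<dots> \<le> real (card (pverts G)) * real (card (pverts G)) ^ k"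
    by (intro mult_right_mono of_nat_mono card_mono[OF assms raters_subset]) simp
  finally show ?case by simp
qed simp

lemma summable_katz:
  assumes "finite (pverts G)"
  shows "summable (\<lambda>k. walks_to G k v * damping G ^ k)"
proof (rule summable_comparison_test')
  let ?q = "real (card (pverts G)) * damping G"
  have "norm ?q < 1"
    by (simp add: damping_def)
  then show "summable (\<lambda>k. ?q ^ k)"
    by (rule summable_geometric)
  show "norm (walks_to G k v * damping G ^ k) \<le> ?q ^ k" for k
    using walks_to_le[OF assms, of k v] walks_to_nonneg[of G k v] damping_pos[of G]
    by (simp add: power_mult_distrib abs_mult)
qed

text \<open>The length-0 term is 1. A longer walk into \<open>v\<close> is a walk into some rater
  \<open>u\<close> of \<open>v\<close> followed by one arc, which accounts for one factor
  \<open>damping G\<close>; the finite sum over raters commutes with the series.\<close>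

lemma katz_eq:
  assumes "finite (pverts G)"
  shows "katz G v = 1 + damping G * (\<Sum>u\<in>raters G v. katz G u)"
proof -
  note sm = summable_katz[OF assms]
  have "katz G v = 1 + (\<Sum>k. walks_to G (Suc k) v * damping G ^ Suc k)"
    using suminf_split_head[OF sm, of v] by (simp add: katz_def)
  also have "(\<lambda>k. walks_to G (Suc k) v * damping G ^ Suc k) =
      (\<lambda>k. damping G * (\<Sum>u\<in>raters G v. walks_to G k u * damping G ^ k))"
    by (simp add: sum_distrib_left sum_distrib_right mult_ac)
  also have "(\<Sum>k. damping G * (\<Sum>u\<in>raters G v. walks_to G k u * damping G ^ k)) =
      damping G * (\<Sum>u\<in>raters G v. katz G u)"
    by (simp add: katz_def suminf_mult suminf_sum summable_sum sm)
  finally show ?thesis .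
qed

lemma katz_pos:
  assumes "finite (pverts G)"
  shows "katz G v > 0"
proof -
  \<comment> \<open>Nonnegative terms only give a weak bound; the constant 1 in the recursion then
    makes it strict.\<close>
  have nonneg: "katz G u \<ge> 0" for u
    unfolding katz_def using damping_pos[of G]
    by (intro suminf_nonneg summable_katz assms) (simp add: walks_to_nonneg)
  then have "damping G * (\<Sum>u\<in>raters G v. katz G u) \<ge> 0"
    using damping_pos[of G] by (simp add: sum_nonneg)
  then show ?thesis
    by (simp add: katz_eq[OF assms, of v])
qed

text \<open>Competition ranking: tied agents share a rank, and the best agents get rank 1.\<close>

definition score_ranking :: "'a set \<Rightarrow> ('a \<Rightarrow> real) \<Rightarrow> 'a \<Rightarrow> nat" where
  "score_ranking V x = (\<lambda>v\<in>V. Suc (card {w \<in> V. x v < x w}))"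

lemma score_ranking_in_social_rankings:
  assumes "finite (pverts G)"
  shows "score_ranking (pverts G) x \<in> social_rankings G"
proof -
  \<comment> \<open>\<open>v\<close> does not beat itself, so the set omits \<open>v\<close> and the
    rank stays within the number of agents.\<close>
  have "card {w \<in> pverts G. x v < x w} < card (pverts G)" if "v \<in> pverts G" for v
    using that assms by (intro psubset_card_mono) auto
  then show ?thesis
    by (auto simp: social_rankings_def score_ranking_def Suc_le_eq)
qed

lemma score_ranking_less:
  assumes "finite V" "v \<in> V" "w \<in> V" "x w < x v"
  shows "score_ranking V x v < score_ranking V x w"
proof -
  \<comment> \<open>The inclusion is strict because \<open>v\<close> belongs only to the right-hand
    set.\<close>
  have "{u \<in> V. x v < x u} \<subset> {u \<in> V. x w < x u}"
    using assms by auto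
  then show ?thesis
    using assms by (simp add: score_ranking_def psubset_card_mono)
qed

lemma ranked_ge_score_ranking:
  assumes "finite V" "v \<in> V" "w \<in> V"
  shows "ranked_ge (score_ranking V x) v w \<longleftrightarrow> x w \<le> x v"
proof
  assume "ranked_ge (score_ranking V x) v w"
  then show "x w \<le> x v"
    using score_ranking_less[OF assms(1,3,2), of x] by (fastforce simp: ranked_ge_def)
next
  assume "x w \<le> x v"
  then show "ranked_ge (score_ranking V x) v w"
    using score_ranking_less[OF assms, of x] assms
    by (cases "x w = x v") (auto simp: ranked_ge_def score_ranking_def)
qed

lemma ranked_gt_score_ranking:
  assumes "finite V" "v \<in> V" "w \<in> V"
  shows "ranked_gt (score_ranking V x) v w \<longleftrightarrow> x w < x v"
  using assms by (auto simp: ranked_gt_def ranked_ge_score_ranking)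

lemma more_important_sum_less:
  fixes x :: "'a \<Rightarrow> real"
  assumes "finite V" "A \<subseteq> V" "B \<subseteq> V" and pos: "\<And>v. v \<in> V \<Longrightarrow> x v > 0"
    and "more_important (score_ranking V x) A B"
  shows "sum x B < sum x A"
proof -
  obtain f where f: "f \<in> B \<rightarrow> A" "inj_on f B"
    and ge: "\<forall>v\<in>B. ranked_ge (score_ranking V x) (f v) v"
    and strict: "f ` B \<noteq> A \<or> (\<exists>v\<in>B. ranked_gt (score_ranking V x) (f v) v)"
    using assms(5) by (auto simp: more_important_def)
  have fin: "finite A" "finite B"
    using assms(1-3) by (auto intro: rev_finite_subset)
  have V: "v \<in> V" "f v \<in> V" if "v \<in> B" for v
    using that f(1) assms(2,3) by auto
  have le: "x v \<le> x (f v)" if "v \<in> B" for v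
    using bspec[OF ge that] V[OF that] assms(1) by (simp add: ranked_ge_score_ranking)
  have nonneg: "0 \<le> x v" if "v \<in> A" for v
    using that assms(2) less_imp_le[OF pos] by auto
  \<comment> \<open>Injectivity of \<open>f\<close> ensures that no score is counted twice.\<close>
  have image: "sum x (f ` B) = (\<Sum>v\<in>B. x (f v))"
    using f by (simp add: sum.reindex)
  have sub: "f ` B \<subseteq> A"
    using f by auto
  have le1: "sum x B \<le> sum x (f ` B)"
    unfolding image by (intro sum_mono le)
  have le2: "sum x (f ` B) \<le> sum x A"
    using fin(1) sub nonneg by (intro sum_mono2) auto
  from strict show ?thesis
  proof
    assume "f ` B \<noteq> A"
    then obtain a where a: "a \<in> A - f ` B"
      using sub by auto
    then have "sum x (f ` B) < sum x A"
      using fin(1) sub nonneg assms(2) pos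
      by (intro sum_strict_mono2[where b = a]) auto
    with le1 show ?thesis by simp
  next
    assume "\<exists>v\<in>B. ranked_gt (score_ranking V x) (f v) v"
    then have "\<exists>v\<in>B. x v < x (f v)"
      using V assms(1) by (auto simp: ranked_gt_score_ranking)
    then have "sum x B < sum x (f ` B)"
      unfolding image using fin le by (intro sum_strict_mono_ex1) auto
    with le2 show ?thesis by simp
  qed
qed

text \<open>By the recursion, the Katz score strictly increases with the total score of the
  raters.\<close>

lemma katz_ranking_transitive:
  assumes "finite (pverts G)" "vi \<in> pverts G" "vj \<in> pverts G"
    and "more_important (score_ranking (pverts G) (katz G)) (raters G vi) (raters G vj)"
  shows "ranked_gt (score_ranking (pverts G) (katz G)) vi vj"
proof -
  have "sum (katz G) (raters G vj) < sum (katz G) (raters G vi)"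
    using assms by (intro more_important_sum_less[of "pverts G"] raters_subset katz_pos)
  then have "katz G vj < katz G vi"
    using damping_pos[of G] by (simp add: katz_eq[OF assms(1), of vi] katz_eq[OF assms(1), of vj])
  then show ?thesis
    using assms by (simp add: ranked_gt_score_ranking)
qed

definition constant_ranking :: "'a set \<Rightarrow> 'a \<Rightarrow> nat" where
  "constant_ranking V = (\<lambda>v\<in>V. 1)"

lemma constant_ranking_in_social_rankings:
  "finite (pverts G) \<Longrightarrow> constant_ranking (pverts G) \<in> social_rankings G"
  by (auto simp: social_rankings_def constant_ranking_def Suc_le_eq card_gt_0_iff)

text \<open>Since all agents tie, the premise of weak monotonicity never holds.\<close>

lemma not_ranked_gt_constant_ranking:
  "v \<in> V \<Longrightarrow> w \<in> V \<Longrightarrow> \<not> ranked_gt (constant_ranking V) v w"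
  by (simp add: ranked_gt_def ranked_ge_def constant_ranking_def)

text \<open>A map from the empty set to itself is onto and has no argument to improve
  strictly.\<close>

lemma not_more_important_empty: "\<not> more_important r {} {}"
  by (simp add: more_important_def)

lemma pair_digraph_arcless: "finite V \<Longrightarrow> pair_digraph \<lparr>pverts = V, parcs = {}\<rparr>"
  by unfold_locales auto

lemma pair_digraph_finite_verts: "pair_digraph G \<Longrightarrow> finite (pverts G)"
  by (rule pair_fin_digraph.pair_finite_verts) (rule pair_digraph.axioms)

theorem theorem2:
  shows "(\<exists>S :: 'a ranking_rule. social_reputation_rule S \<and> generality S \<and> transitivity S) \<and>
         (\<exists>S :: 'a ranking_rule. social_reputation_rule S \<and> generality S \<and> weak_monotonicity S) \<and>
         (\<exists>S :: 'a ranking_rule. social_reputation_rule S \<and> transitivity S \<and> weak_monotonicity S)"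
proof (intro conjI)
  \<comment> \<open>The graph without vertices shows that the domains of all three rules are
    nonempty, whatever the type of agents.\<close>
  have nonempty: "\<exists>G :: 'a pair_pre_digraph. pair_digraph G \<and> parcs G = {}"
    using pair_digraph_arcless[of "{}"] by fastforce
  let ?K = "\<lambda>G :: 'a pair_pre_digraph.
    if pair_digraph G then Some (score_ranking (pverts G) (katz G)) else None"
  have "social_reputation_rule ?K"
    using nonempty unfolding social_reputation_rule_def
    by (auto simp: dom_def score_ranking_in_social_rankings pair_digraph_finite_verts)
  moreover have "generality ?K"
    by (simp add: generality_def dom_def)
  moreover have "transitivity ?K"
    by (auto simp: transitivity_def katz_ranking_transitive pair_digraph_finite_verts)
  ultimately show "\<exists>S :: 'a ranking_rule. social_reputation_rule S \<and> generality S \<and> transitivity S"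
    by blast
  let ?C = "\<lambda>G :: 'a pair_pre_digraph.
    if pair_digraph G then Some (constant_ranking (pverts G)) else None"
  have "social_reputation_rule ?C"
    using nonempty unfolding social_reputation_rule_def
    by (auto simp: dom_def constant_ranking_in_social_rankings pair_digraph_finite_verts)
  moreover have "generality ?C"
    by (simp add: generality_def dom_def)
  moreover have "weak_monotonicity ?C"
    by (auto simp: weak_monotonicity_def not_ranked_gt_constant_ranking)
  ultimately show "\<exists>S :: 'a ranking_rule. social_reputation_rule S \<and> generality S \<and> weak_monotonicity S"
    by blast
  \<comment> \<open>Without arcs every rater set is empty, so the premise of transitivity never
    holds.\<close>
  let ?A = "\<lambda>G :: 'a pair_pre_digraph.
    if pair_digraph G \<and> parcs G = {} then Some (constant_ranking (pverts G)) else None"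
  have "social_reputation_rule ?A"
    using nonempty unfolding social_reputation_rule_def
    by (auto simp: dom_def constant_ranking_in_social_rankings pair_digraph_finite_verts)
  moreover have "transitivity ?A"
    by (auto simp: transitivity_def raters_def not_more_important_empty)
  moreover have "weak_monotonicity ?A"
    by (auto simp: weak_monotonicity_def not_ranked_gt_constant_ranking)
  ultimately show "\<exists>S :: 'a ranking_rule. social_reputation_rule S \<and> transitivity S \<and> weak_monotonicity S"
    by blast
qed

end
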